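(* Let $n,m,r$ be arbitrary positive integers and let $k_1,k_2$ be positive integers with $k_1,k_2\le r$. Then $A_r(n,m,k_1)=A_r(n,m,k_2)$.
   Context: $[n]=\{1,\dots,n\}$, and a permutation of $[n]$ is a bijection $\sigma:[n]\to[n]$. An $r$-descent of $\sigma$ is a position $i$ with $1\le i<n$ and $\sigma(i)\ge\sigma(i+1)+r$. $A_r(n,m,k)$ denotes the number of permutations $\sigma$ of $[n]$ with exactly $m$ $r$-descents and $\sigma(n)=k$ (so it is $0$ if no such permutation exists). *)

theory Defs
  imports "HOL-Combinatorics.Permutations"
begin

definition r_descents :: "nat \<Rightarrow> nat \<Rightarrow> (nat \<Rightarrow> nat) \<Rightarrow> nat set" where
  "r_descents r n \<sigma> = {i. 1 \<le> i \<and> i < n \<and> \<sigma> i \<ge> \<sigma> (i + 1) + r}"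

text \<open>A permutation of \<open>{1..n}\<close> is represented by its extension to all of \<open>nat\<close> by the
  identity, so that distinct functions in the set below are distinct permutations.\<close>

definition A :: "nat \<Rightarrow> nat \<Rightarrow> nat \<Rightarrow> nat \<Rightarrow> nat" where
  "A r n m k = card {\<sigma>. \<sigma> permutes {1..n} \<and> card (r_descents r n \<sigma>) = m \<and> \<sigma> n = k}"

end

(* Read a permutation with last value at most r as a cyclic word. The wrap-around pair is never an
   r-descent, because its first entry is at most r, so the number of r-descents is the number of
   cyclic r-descents, which is invariant under rotation. Rotating the word so that it ends in k2
   instead of k1 therefore maps the permutations counted by A r n m k1 injectively into those
   counted by A r n m k2. *)
theory Submission
  imports Defs "HOL-Combinatorics.Cycles"
begin

text \<open>For \<open>n \<ge> 1\<close> it fixes everything outside \<open>{1..n}\<close>, as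
  \<open>permutes\<close> demands, so rotating a word is composing with a power of
  \<open>cyc n\<close> on the right.\<close>

definition cyc :: "nat \<Rightarrow> nat \<Rightarrow> nat" where
  "cyc n i = (if 1 \<le> i \<and> i < n then Suc i else if i = n then 1 else i)"

lemma permutes_cyc:
  assumes "n \<ge> 1"
  shows "cyc n permutes {1..n}"
proof (rule bij_imp_permutes)
  have "inj_on (cyc n) {1..n}"
    by (auto simp: inj_on_def cyc_def split: if_splits)
  moreover have "cyc n ` {1..n} \<subseteq> {1..n}"
    using assms by (auto simp: cyc_def)
  ultimately show "bij_betw (cyc n) {1..n} {1..n}"
    by (simp add: bij_betw_def endo_inj_surj)
qed (use assms in \<open>auto simp: cyc_def\<close>)

lemma permutes_cyc_funpow:
  assumes "n \<ge> 1"
  shows "(cyc n ^^ p) permutes {1..n}"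
  using permutes_cyc[OF assms] by (rule permutes_funpow)

text \<open>The shift sends n to 1 and then counts upwards. Hence precomposing with the j-th power
  moves the entry at position j to the end.\<close>

lemma cyc_funpow_last:
  assumes "1 \<le> j" "j \<le> n"
  shows "(cyc n ^^ j) n = j"
  using assms by (induction j rule: dec_induct) (auto simp: cyc_def)

definition cyclic_descents :: "nat \<Rightarrow> nat \<Rightarrow> (nat \<Rightarrow> nat) \<Rightarrow> nat set" where
  "cyclic_descents r n \<sigma> = {i \<in> {1..n}. \<sigma> i \<ge> \<sigma> (cyc n i) + r}"

text \<open>Only position n could differ, and a descent there would give
  \<open>\<sigma> n \<ge> \<sigma> 1 + r > r\<close>.\<close>

lemma r_descents_eq_cyclic_descents:
  assumes "\<sigma> permutes {1..n}" "\<sigma> n \<le> r"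
  shows "r_descents r n \<sigma> = cyclic_descents r n \<sigma>"
proof (cases "n \<ge> 1")
  case True
  then have "\<sigma> 1 \<ge> 1"
    using permutes_in_image[OF assms(1), of 1] by simp
  then show ?thesis
    using assms(2) by (auto simp: r_descents_def cyclic_descents_def cyc_def split: if_splits)
qed (auto simp: r_descents_def cyclic_descents_def)

text \<open>Powers of \<open>cyc n\<close> commute with \<open>cyc n\<close>, so the new descent set
  is the preimage of the old one under a bijection.\<close>

lemma card_cyclic_descents_rotate:
  assumes "n \<ge> 1"
  shows "card (cyclic_descents r n (\<sigma> \<circ> (cyc n ^^ p))) = card (cyclic_descents r n \<sigma>)"
proof -
  let ?c = "cyc n ^^ p"
  have perm: "?c permutes {1..n}"
    using assms by (rule permutes_cyc_funpow)
  have "?c -` cyclic_descents r n \<sigma> = cyclic_descents r n (\<sigma> \<circ> ?c)"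
    using permutes_in_image[OF perm]
    by (auto simp: cyclic_descents_def funpow_swap1)
  then show ?thesis
    using card_vimage_inj[OF permutes_inj[OF perm], of "cyclic_descents r n \<sigma>"]
      permutes_surj[OF perm] by simp
qed

text \<open>Cancelling p shifts shows that the words differ by a rotation through
  \<open>q - p\<close> places. As the entries of \<open>\<tau>\<close> are distinct, equal last
  entries force this rotation to be trivial.\<close>

lemma rotate_eq_imp_eq:
  assumes "\<sigma> \<circ> (cyc n ^^ p) = \<tau> \<circ> (cyc n ^^ q)" "p \<le> q" "1 \<le> p" "q \<le> n"
    and "\<tau> permutes {1..n}" "\<sigma> n = \<tau> n"
  shows "\<sigma> = \<tau>"
proof -
  have "surj (cyc n ^^ p)"
    using assms(2-4) by (intro permutes_surj[OF permutes_cyc_funpow]) auto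
  moreover have "\<sigma> ((cyc n ^^ p) i) = \<tau> ((cyc n ^^ (q - p)) ((cyc n ^^ p) i))" for i
  proof -
    have "cyc n ^^ q = (cyc n ^^ (q - p)) \<circ> (cyc n ^^ p)"
      using assms(2) by (simp flip: funpow_add)
    then show ?thesis
      using fun_cong[OF assms(1), of i] by simp
  qed
  ultimately have eq: "\<sigma> = \<tau> \<circ> (cyc n ^^ (q - p))"
    by (metis comp_apply ext surjD)
  then have "\<tau> ((cyc n ^^ (q - p)) n) = \<tau> n"
    using assms(6) by simp
  then have "(cyc n ^^ (q - p)) n = n"
    using permutes_inj[OF assms(5)] by (simp add: inj_eq)
  \<comment> \<open>Otherwise the power would send n to \<open>q - p\<close>, which is less than n
    because \<open>1 \<le> p\<close> and \<open>q \<le> n\<close>.\<close>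
  then have "q - p = 0"
    using cyc_funpow_last[of "q - p" n] assms(2-4) by (cases "q - p = 0") auto
  then show ?thesis
    using eq by simp
qed

lemma A_le_A:
  assumes "k\<^sub>1 \<le> r" "1 \<le> k\<^sub>2" "k\<^sub>2 \<le> r" "k\<^sub>2 \<le> n"
  shows "A r n m k\<^sub>1 \<le> A r n m k\<^sub>2"
proof -
  define S where
    "S k = {\<sigma>. \<sigma> permutes {1..n} \<and> card (r_descents r n \<sigma>) = m \<and> \<sigma> n = k}" for k
  \<comment> \<open>The position of \<open>k\<^sub>2\<close> in the word; it exists because
    \<open>1 \<le> k\<^sub>2 \<le> n\<close>.\<close>
  define pos where "pos \<sigma> = inv \<sigma> k\<^sub>2" for \<sigma> :: "nat \<Rightarrow> nat"
  define rot where "rot \<sigma> = \<sigma> \<circ> (cyc n ^^ pos \<sigma>)" for \<sigma> :: "nat \<Rightarrow> nat"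
  have n: "n \<ge> 1"
    using assms by simp
  have pos: "1 \<le> pos \<sigma> \<and> pos \<sigma> \<le> n" "\<sigma> (pos \<sigma>) = k\<^sub>2" if "\<sigma> permutes {1..n}" for \<sigma>
    using permutes_in_image[OF permutes_inv[OF that], of k\<^sub>2] permutes_inverses(1)[OF that] assms
    by (auto simp: pos_def)
  have "rot \<sigma> \<in> S k\<^sub>2" if "\<sigma> \<in> S k\<^sub>1" for \<sigma>
  proof -
    have perm: "\<sigma> permutes {1..n}" and card: "card (r_descents r n \<sigma>) = m" and "\<sigma> n = k\<^sub>1"
      using that by (auto simp: S_def)
    have perm': "rot \<sigma> permutes {1..n}"
      unfolding rot_def using perm permutes_cyc_funpow[OF n] by (intro permutes_compose)
    have last: "rot \<sigma> n = k\<^sub>2"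
      using cyc_funpow_last[of "pos \<sigma>" n] pos[OF perm] by (simp add: rot_def)
    have "card (r_descents r n (rot \<sigma>)) = card (cyclic_descents r n (rot \<sigma>))"
      using r_descents_eq_cyclic_descents[OF perm'] last assms by simp
    also have "\<dots> = card (cyclic_descents r n \<sigma>)"
      unfolding rot_def using n by (rule card_cyclic_descents_rotate)
    also have "\<dots> = m"
      using r_descents_eq_cyclic_descents[OF perm] card \<open>\<sigma> n = k\<^sub>1\<close> assms by simp
    finally show ?thesis
      using perm' last by (simp add: S_def)
  qed
  moreover have "inj_on rot (S k\<^sub>1)"
  proof (rule inj_onI)
    fix \<sigma> \<tau>
    assume "\<sigma> \<in> S k\<^sub>1" "\<tau> \<in> S k\<^sub>1" and eq: "rot \<sigma> = rot \<tau>"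
    then have perm: "\<sigma> permutes {1..n}" "\<tau> permutes {1..n}" and last: "\<sigma> n = \<tau> n"
      by (auto simp: S_def)
    note eq = eq[unfolded rot_def]
    show "\<sigma> = \<tau>"
    \<comment> \<open>The cancellation needs the smaller shift on the left, so the roles are swapped
      in the second case.\<close>
    proof (cases "pos \<sigma> \<le> pos \<tau>")
      case True
      then show ?thesis
        using rotate_eq_imp_eq[OF eq] pos perm last by blast
    next
      case False
      then show ?thesis
        using rotate_eq_imp_eq[OF eq[symmetric]] pos perm last by (metis nle_le)
    qed
  qed
  moreover have "finite (S k\<^sub>2)"
    by (rule finite_subset[OF _ finite_permutations[of "{1..n}"]]) (auto simp: S_def)
  ultimately have "card (S k\<^sub>1) \<le> card (S k\<^sub>2)"
    by (intro card_inj_on_le[of rot]) auto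
  then show ?thesis
    by (simp add: A_def S_def)
qed

text \<open>Two values in \<open>{1..n}\<close> differ by at most \<open>n - 1 < r\<close>.\<close>

lemma r_descents_eq_empty:
  assumes "\<sigma> permutes {1..n}" "n \<le> r"
  shows "r_descents r n \<sigma> = {}"
proof -
  have "\<sigma> i < \<sigma> (i + 1) + r" if "1 \<le> i" "i < n" for i
    using that permutes_in_image[OF assms(1), of i] permutes_in_image[OF assms(1), of "i + 1"]
      assms(2) by auto
  then show ?thesis
    by (fastforce simp: r_descents_def)
qed

theorem theorem6:
  fixes n m r k\<^sub>1 k\<^sub>2 :: nat
  assumes "n \<ge> 1" and "m \<ge> 1" and "r \<ge> 1"
    and "k\<^sub>1 \<ge> 1" and "k\<^sub>2 \<ge> 1"
    and "k\<^sub>1 \<le> r" and "k\<^sub>2 \<le> r"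
  shows "A r n m k\<^sub>1 = A r n m k\<^sub>2"
proof (cases "n \<le> r")
  case True
  then have "{\<sigma>. \<sigma> permutes {1..n} \<and> card (r_descents r n \<sigma>) = m \<and> \<sigma> n = k} = {}" for k
    using r_descents_eq_empty[of _ n r] assms(2) by fastforce
  then show ?thesis
    by (simp only: A_def)
next
  case False
  \<comment> \<open>Now \<open>r < n\<close> puts both last values in \<open>{1..n}\<close>, and the
    inequality applies in both directions.\<close>
  then show ?thesis
    using assms by (intro antisym A_le_A) auto
qed

end
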